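(* There is a ranked alphabet $\Sigma$ and a murg TRS $R$ over $\Sigma$ such that $R$ is not a P$\Sigma$RF-TRS.
   Context: A ranked alphabet $\Sigma$ is a finite set of symbols with ranks; $X$ a countable set of variables, $T_\Sigma(X)$ the terms, $T_\Sigma$ the ground terms; the height of a variable or constant is $0$. A TRS over $\Sigma$ is a finite set of rules $l\to r$, $l,r\in T_\Sigma(X)$, with every variable of $r$ occurring in $l$. A TRS is monadic if each left-hand side has height at least $1$ and each right-hand side has height at most $1$; right-ground if each right-hand side is ground; murg if it is the union of a monadic TRS and a right-ground TRS. $R^*_\Sigma(L)=\{p\mid q\Rightarrow^*_R p,\ q\in L\}$. A tree language is recognizable if recognized by a bottom-up tree automaton. $R$ is a P$\Sigma$RF-TRS if $R^*_\Sigma(L)$ is recognizable for every finite $L\subseteq T_\Sigma$. *)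

theory Defs
  imports Main
begin

datatype ('f, vars: 'v) trm = Var 'v | Fun 'f "('f, 'v) trm list"

(* The rank function is total on the symbol type; only its values on
   "symbols \<Sigma>" matter. *)
record 'f signature =
  symbols :: "'f set"
  rank :: "'f \<Rightarrow> nat"

definition ranked_alphabet :: "'f signature \<Rightarrow> bool" where
  "ranked_alphabet \<Sigma> \<longleftrightarrow> finite (symbols \<Sigma>)"

inductive_set terms :: "'f signature \<Rightarrow> ('f, 'v) trm set"
  for \<Sigma> :: "'f signature" where
  Var: "Var x \<in> terms \<Sigma>"
| Fun: "\<lbrakk>f \<in> symbols \<Sigma>; length ts = rank \<Sigma> f; \<And>t. t \<in> set ts \<Longrightarrow> t \<in> terms \<Sigma>\<rbrakk>
    \<Longrightarrow> Fun f ts \<in> terms \<Sigma>"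

definition ground :: "('f, 'v) trm \<Rightarrow> bool" where
  "ground t \<longleftrightarrow> vars t = {}"

definition ground_terms :: "'f signature \<Rightarrow> ('f, 'v) trm set" where
  "ground_terms \<Sigma> = {t \<in> terms \<Sigma>. ground t}"

primrec height :: "('f, 'v) trm \<Rightarrow> nat" where
  "height (Var x) = 0"
| "height (Fun f ts) = (if ts = [] then 0 else Suc (Max (set (map height ts))))"

primrec subst :: "('v \<Rightarrow> ('f, 'v) trm) \<Rightarrow> ('f, 'v) trm \<Rightarrow> ('f, 'v) trm" where
  "subst \<sigma> (Var x) = \<sigma> x"
| "subst \<sigma> (Fun f ts) = Fun f (map (subst \<sigma>) ts)"

type_synonym ('f, 'v) rules = "(('f, 'v) trm \<times> ('f, 'v) trm) set"

definition trs :: "'f signature \<Rightarrow> ('f, 'v) rules \<Rightarrow> bool" where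
  "trs \<Sigma> R \<longleftrightarrow> finite R \<and>
     (\<forall>(l, r) \<in> R. l \<in> terms \<Sigma> \<and> r \<in> terms \<Sigma> \<and> vars r \<subseteq> vars l)"

definition monadic_trs :: "'f signature \<Rightarrow> ('f, 'v) rules \<Rightarrow> bool" where
  "monadic_trs \<Sigma> R \<longleftrightarrow> trs \<Sigma> R \<and> (\<forall>(l, r) \<in> R. 1 \<le> height l \<and> height r \<le> 1)"

definition right_ground_trs :: "'f signature \<Rightarrow> ('f, 'v) rules \<Rightarrow> bool" where
  "right_ground_trs \<Sigma> R \<longleftrightarrow> trs \<Sigma> R \<and> (\<forall>(l, r) \<in> R. ground r)"

definition murg_trs :: "'f signature \<Rightarrow> ('f, 'v) rules \<Rightarrow> bool" where
  "murg_trs \<Sigma> R \<longleftrightarrow>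
     (\<exists>R1 R2. monadic_trs \<Sigma> R1 \<and> right_ground_trs \<Sigma> R2 \<and> R = R1 \<union> R2)"

(* Substitutions need not be restricted to terms over \<Sigma>: if R is a TRS over \<Sigma> and
   the source is a term over \<Sigma>, the matched variables are bound to terms over \<Sigma>
   and no other variable occurs in the right-hand side. *)
inductive rstep :: "('f, 'v) rules \<Rightarrow> ('f, 'v) trm \<Rightarrow> ('f, 'v) trm \<Rightarrow> bool"
  for R :: "('f, 'v) rules" where
  root: "(l, r) \<in> R \<Longrightarrow> rstep R (subst \<sigma> l) (subst \<sigma> r)"
| arg: "rstep R s t \<Longrightarrow> rstep R (Fun f (us @ s # vs)) (Fun f (us @ t # vs))"

definition descendants :: "('f, 'v) rules \<Rightarrow> ('f, 'v) trm set \<Rightarrow> ('f, 'v) trm set" where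
  "descendants R L = {p. \<exists>q \<in> L. (rstep R)\<^sup>*\<^sup>* q p}"

(* Nondeterministic bottom-up tree automata: a triple (f, [q1, ..., qn], q) in
   "transitions" is the rule f(q1, ..., qn) \<rightarrow> q, and a pair (q, q') in "lambdas" is
   the lambda-rule q \<rightarrow> q'. *)
record ('f, 'q) automaton =
  states :: "'q set"
  final :: "'q set"
  transitions :: "('f \<times> 'q list \<times> 'q) set"
  lambdas :: "('q \<times> 'q) set"

definition bottom_up_automaton :: "'f signature \<Rightarrow> ('f, 'q) automaton \<Rightarrow> bool" where
  "bottom_up_automaton \<Sigma> A \<longleftrightarrow>
     finite (states A) \<and> final A \<subseteq> states A \<and>
     (\<forall>(f, qs, q) \<in> transitions A.
        f \<in> symbols \<Sigma> \<and> length qs = rank \<Sigma> f \<and> set qs \<subseteq> states A \<and> q \<in> states A) \<and>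
     lambdas A \<subseteq> states A \<times> states A"

inductive reaches :: "('f, 'q) automaton \<Rightarrow> ('f, 'v) trm \<Rightarrow> 'q \<Rightarrow> bool"
  for A :: "('f, 'q) automaton" where
  trans: "\<lbrakk>(f, qs, q) \<in> transitions A; list_all2 (reaches A) ts qs\<rbrakk>
    \<Longrightarrow> reaches A (Fun f ts) q"
| lambda: "\<lbrakk>reaches A t q; (q, q') \<in> lambdas A\<rbrakk> \<Longrightarrow> reaches A t q'"

definition language :: "'f signature \<Rightarrow> ('f, 'q) automaton \<Rightarrow> ('f, 'v) trm set" where
  "language \<Sigma> A = {t \<in> ground_terms \<Sigma>. \<exists>q \<in> final A. reaches A t q}"

(* Natural numbers as states are no restriction, the state set being finite. *)
definition recognizable :: "'f signature \<Rightarrow> ('f, 'v) trm set \<Rightarrow> bool" where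
  "recognizable \<Sigma> L \<longleftrightarrow>
     (\<exists>A :: ('f, nat) automaton. bottom_up_automaton \<Sigma> A \<and> language \<Sigma> A = L)"

definition PSRF_trs :: "'f signature \<Rightarrow> ('f, 'v) rules \<Rightarrow> bool" where
  "PSRF_trs \<Sigma> R \<longleftrightarrow> trs \<Sigma> R \<and>
     (\<forall>L. finite L \<and> L \<subseteq> ground_terms \<Sigma> \<longrightarrow> recognizable \<Sigma> (descendants R L))"

end

(* The ground rules let the constants c and d grow independently into towers s^n(c) or s^n(e),
   respectively s^n(d) or s^n(e). The left-hand side of f(x,x) \<rightarrow> g(x,x) is not linear, so
   starting from f(c,d) it applies only when both arguments have become the same normal form
   s^n(e). Hence the descendants with root g are exactly the terms g(s^n(e),s^n(e)), and by the
   pigeonhole principle no tree automaton accepts all of these without accepting some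
   g(s^m(e),s^n(e)) with m \<noteq> n. *)
theory Submission
  imports Defs
begin

lemma rstep_Fun_cases:
  assumes "rstep R (Fun f ts) t'"
  obtains (root) l r \<sigma> where "(l, r) \<in> R" "Fun f ts = subst \<sigma> l" "t' = subst \<sigma> r"
  | (arg) us s vs s' where "ts = us @ s # vs" "rstep R s s'" "t' = Fun f (us @ s' # vs)"
  using assms by (cases rule: rstep.cases) auto

lemma reaches_in_states:
  assumes "bottom_up_automaton \<Sigma> A" and "reaches A t q"
  shows "q \<in> states A"
  using assms(2,1) by (induction) (auto simp: bottom_up_automaton_def)

text \<open>A run sees an argument only through the states that the argument reaches. The root
  transition may be followed by any number of lambda-rules, hence the induction on
  \<open>reaches\<close>.\<close>

lemma reaches_Fun_mono:
  assumes "reaches A (Fun f ts) q"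
    and "list_all2 (\<lambda>t t'. \<forall>q. reaches A t q \<longrightarrow> reaches A t' q) ts ts'"
  shows "reaches A (Fun f ts') q"
  using assms
proof (induction "Fun f ts" q rule: reaches.induct)
  case (trans qs q)
  have "list_all2 (reaches A) ts qs"
    using trans.hyps(2) by (rule list_all2_mono) simp
  then have "list_all2 (reaches A) ts' qs"
    using trans.prems by (auto simp: list_all2_conv_all_nth)
  then show ?case
    using trans.hyps(1) by (blast intro: reaches.trans)
next
  case (lambda q q')
  then show ?case
    by (blast intro: reaches.lambda)
qed

text \<open>A finite state set has finitely many subsets, so two terms of the infinite family reach
  exactly the same states, and the automaton cannot tell them apart below \<open>g\<close>.\<close>

lemma recognizable_pigeonhole:
  fixes t :: "nat \<Rightarrow> ('f, 'v) trm"
  assumes "recognizable \<Sigma> L"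
    and diag: "\<And>n. Fun g [t n, t n] \<in> L"
    and ground: "\<And>m n. Fun g [t m, t n] \<in> ground_terms \<Sigma>"
  shows "\<exists>m n. m \<noteq> n \<and> Fun g [t m, t n] \<in> L"
proof -
  obtain A :: "('f, nat) automaton"
    where A: "bottom_up_automaton \<Sigma> A" and L: "language \<Sigma> A = L"
    using assms(1) by (auto simp: recognizable_def)
  \<comment> \<open>The automaton is nondeterministic, so the pigeonholes are sets of states, not
    single states.\<close>
  let ?Q = "\<lambda>n. {q. reaches A (t n) q}"
  have "range ?Q \<subseteq> Pow (states A)"
    using reaches_in_states[OF A] by auto
  moreover have "finite (states A)"
    using A by (simp add: bottom_up_automaton_def)
  ultimately have "finite (range ?Q)"
    by (meson finite_Pow_iff finite_subset)
  then have "\<not> inj ?Q"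
    using finite_imageD infinite_UNIV_nat by blast
  then obtain m n where mn: "m \<noteq> n" "?Q m = ?Q n"
    by (auto simp: inj_def)
  obtain q where q: "q \<in> final A" "reaches A (Fun g [t m, t m]) q"
    using diag[of m] L by (auto simp: language_def)
  have "reaches A (Fun g [t m, t n]) q"
    by (rule reaches_Fun_mono[OF q(2)]) (use mn(2) in auto)
  then have "Fun g [t m, t n] \<in> L"
    using q(1) ground L by (auto simp: language_def)
  with mn(1) show ?thesis
    by blast
qed

abbreviation (input) symf :: nat where "symf \<equiv> 0"
abbreviation (input) symg :: nat where "symg \<equiv> 1"
abbreviation (input) syms :: nat where "syms \<equiv> 2"
abbreviation (input) symc :: nat where "symc \<equiv> 3"
abbreviation (input) symd :: nat where "symd \<equiv> 4"
abbreviation (input) syme :: nat where "syme \<equiv> 5"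

text \<open>The numbering puts the binary symbols \<open>symf\<close> and \<open>symg\<close> first,
  then the unary \<open>syms\<close>, then the constants.\<close>

definition tower_sig :: "nat signature" where
  "tower_sig = \<lparr>symbols = {symf, symg, syms, symc, symd, syme},
     rank = (\<lambda>k. if k \<le> symg then 2 else if k = syms then 1 else 0)\<rparr>"

definition copy_rules :: "(nat, nat) rules" where
  "copy_rules = {(Fun symf [Var 0, Var 0], Fun symg [Var 0, Var 0])}"

text \<open>The left-hand sides are constants, of height 0, which a monadic TRS forbids; these rules
  enter as the right-ground part.\<close>

definition growth_rules :: "(nat, nat) rules" where
  "growth_rules =
     {(Fun symc [], Fun syms [Fun symc []]), (Fun symc [], Fun syme []),
      (Fun symd [], Fun syms [Fun symd []]), (Fun symd [], Fun syme [])}"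

definition tower_rules :: "(nat, nat) rules" where
  "tower_rules = copy_rules \<union> growth_rules"

primrec tower :: "nat \<Rightarrow> nat \<Rightarrow> (nat, nat) trm" where
  "tower z 0 = Fun z []"
| "tower z (Suc n) = Fun syms [tower z n]"

lemma vars_tower [simp]: "vars (tower z n) = {}"
  by (induction n) auto

lemma tower_in_terms:
  "z \<in> {symc, symd, syme} \<Longrightarrow> tower z n \<in> terms tower_sig"
  by (induction n) (auto intro!: terms.intros simp: tower_sig_def)

lemma tower_eq_iff:
  assumes "z \<noteq> syms" "z' \<noteq> syms"
  shows "tower z m = tower z' n \<longleftrightarrow> z = z' \<and> m = n"
proof (induction m arbitrary: n)
  case 0
  then show ?case using assms by (cases n) auto
next
  case (Suc m)
  then show ?case using assms by (cases n) auto
qed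

lemma trs_copy_rules: "trs tower_sig copy_rules"
  by (auto simp: trs_def copy_rules_def tower_sig_def intro!: terms.intros)

lemma trs_growth_rules: "trs tower_sig growth_rules"
  by (auto simp: trs_def growth_rules_def tower_sig_def intro!: terms.intros)

lemma murg_tower_rules: "murg_trs tower_sig tower_rules"
proof -
  have "monadic_trs tower_sig copy_rules"
    using trs_copy_rules by (auto simp: monadic_trs_def copy_rules_def)
  moreover have "right_ground_trs tower_sig growth_rules"
    using trs_growth_rules by (auto simp: right_ground_trs_def growth_rules_def ground_def)
  ultimately show ?thesis
    unfolding murg_trs_def tower_rules_def by blast
qed

text \<open>No left-hand side starts with \<open>syms\<close>, so only the bottom constant can be
  rewritten. The first conjunct makes towers over \<open>syme\<close> normal forms.\<close>

lemma rstep_tower: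
  assumes "rstep tower_rules (tower z n) t" and "z \<noteq> symf"
  shows "z \<in> {symc, symd} \<and> (\<exists>z' m. z' \<in> {z, syme} \<and> t = tower z' m)"
  using assms(1)
proof (induction n arbitrary: t)
  case 0
  then have "rstep tower_rules (Fun z []) t"
    by simp
  then show ?case
  proof (cases rule: rstep_Fun_cases)
    case (root l r \<sigma>)
    then consider "z \<in> {symc, symd}" "t = tower z 1" | "z \<in> {symc, symd}" "t = tower syme 0"
      using assms(2) by (auto simp: tower_rules_def copy_rules_def growth_rules_def)
    then show ?thesis
      by cases blast+
  qed simp
next
  case (Suc n)
  then have "rstep tower_rules (Fun syms [tower z n]) t"
    by simp
  then show ?case
  proof (cases rule: rstep_Fun_cases)
    case (root l r \<sigma>)
    then show ?thesis
      by (auto simp: tower_rules_def copy_rules_def growth_rules_def)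
  next
    case (arg us s vs s')
    then have "rstep tower_rules (tower z n) s'" "t = Fun syms [s']"
      by (auto simp: Cons_eq_append_conv)
    then show ?thesis
      using Suc.IH[of s'] by (metis tower.simps(2))
  qed
qed

text \<open>This is the invariant for rewriting from f(c,d). The heights \<open>m\<close> and
  \<open>n\<close> are unrelated under \<open>symf\<close> and equal under
  \<open>symg\<close>.\<close>

inductive tower_config :: "(nat, nat) trm \<Rightarrow> bool" where
  growing: "\<lbrakk>y \<in> {symc, syme}; z \<in> {symd, syme}\<rbrakk>
    \<Longrightarrow> tower_config (Fun symf [tower y m, tower z n])"
| copied: "tower_config (Fun symg [tower syme n, tower syme n])"

lemma rstep_tower_config:
  assumes "tower_config t" and "rstep tower_rules t t'"
  shows "tower_config t'"
  using assms
proof (cases rule: tower_config.cases)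
  case (growing y z m n)
  have "rstep tower_rules (Fun symf [tower y m, tower z n]) t'"
    using assms(2) growing(1) by simp
  then show ?thesis
  proof (cases rule: rstep_Fun_cases)
    case (root l r \<sigma>)
    then have eq: "tower y m = tower z n" and t': "t' = Fun symg [tower y m, tower z n]"
      by (auto simp: tower_rules_def copy_rules_def growth_rules_def)
    \<comment> \<open>The bases allowed on the two sides have only \<open>syme\<close> in common, so
      the nonlinear match yields two equal towers over \<open>syme\<close>.\<close>
    have "y = z" "m = n"
      using eq growing(2,3) by (auto simp: tower_eq_iff)
    then show ?thesis
      using t' growing(2,3) copied by auto
  next
    case (arg us s vs s')
    then consider "rstep tower_rules (tower y m) s'" "t' = Fun symf [s', tower z n]"
      | "rstep tower_rules (tower z n) s'" "t' = Fun symf [tower y m, s']"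
      by (auto simp: Cons_eq_append_conv)
    then show ?thesis
    proof cases
      case 1
      have "y \<noteq> symf" using growing(2) by auto
      from rstep_tower[OF 1(1) this] show ?thesis
        using 1(2) growing(2,3) by (auto intro!: tower_config.growing)
    next
      case 2
      have "z \<noteq> symf" using growing(3) by auto
      from rstep_tower[OF 2(1) this] show ?thesis
        using 2(2) growing(2,3) by (auto intro!: tower_config.growing)
    qed
  qed
next
  case (copied n)
  have "rstep tower_rules (Fun symg [tower syme n, tower syme n]) t'"
    using assms(2) copied by simp
  then show ?thesis
  proof (cases rule: rstep_Fun_cases)
    case (root l r \<sigma>)
    then show ?thesis
      by (auto simp: tower_rules_def copy_rules_def growth_rules_def)
  next
    case (arg us s vs s')
    then have "rstep tower_rules (tower syme n) s'"
      by (auto simp: Cons_eq_append_conv)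
    \<comment> \<open>Towers over \<open>syme\<close> are normal forms, so the two copies can no
      longer diverge.\<close>
    from rstep_tower[OF this] show ?thesis
      by simp
  qed
qed

lemma descendants_tower_config:
  assumes "tower_config t" and "(rstep tower_rules)\<^sup>*\<^sup>* t t'"
  shows "tower_config t'"
  using assms(2,1) by (induction rule: rtranclp_induct) (auto intro: rstep_tower_config)

lemma rsteps_arg:
  "(rstep R)\<^sup>*\<^sup>* s t \<Longrightarrow> (rstep R)\<^sup>*\<^sup>* (Fun f (us @ s # vs)) (Fun f (us @ t # vs))"
  by (induction rule: rtranclp_induct) (auto intro: rtranclp.rtrancl_into_rtrancl rstep.arg)

lemma rsteps_tower:
  assumes "z \<in> {symc, symd}"
  shows "(rstep tower_rules)\<^sup>*\<^sup>* (tower z 0) (tower syme n)"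
proof (induction n)
  case 0
  have "rstep tower_rules (tower z 0) (tower syme 0)"
    \<comment> \<open>The rule is ground, so \<open>Var\<close> is merely a dummy
      substitution.\<close>
    using assms rstep.root[of "tower z 0" "tower syme 0" tower_rules Var]
    by (auto simp: tower_rules_def growth_rules_def)
  then show ?case by blast
next
  case (Suc n)
  have "rstep tower_rules (tower z 0) (tower z 1)"
    using assms rstep.root[of "tower z 0" "tower z 1" tower_rules Var]
    by (auto simp: tower_rules_def growth_rules_def)
  \<comment> \<open>After the first growth step the whole derivation of the induction hypothesis
    runs below the new outer \<open>syms\<close>.\<close>
  moreover have "(rstep tower_rules)\<^sup>*\<^sup>* (tower z 1) (tower syme (Suc n))"
    using rsteps_arg[OF Suc.IH, of syms "[]" "[]"] by simp
  ultimately show ?case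
    by (rule converse_rtranclp_into_rtranclp)
qed

text \<open>Independent growth can still be stopped at the same height on both sides, after which
  the copying rule applies.\<close>

lemma copied_tower_reachable:
  "(rstep tower_rules)\<^sup>*\<^sup>* (Fun symf [tower symc 0, tower symd 0])
     (Fun symg [tower syme n, tower syme n])"
proof -
  have "(rstep tower_rules)\<^sup>*\<^sup>* (Fun symf [tower symc 0, tower symd 0])
      (Fun symf [tower syme n, tower symd 0])"
    using rsteps_arg[OF rsteps_tower[of symc n], of symf "[]" "[tower symd 0]"] by simp
  also have "(rstep tower_rules)\<^sup>*\<^sup>* \<dots> (Fun symf [tower syme n, tower syme n])"
    using rsteps_arg[OF rsteps_tower[of symd n], of symf "[tower syme n]" "[]"] by simp
  also have "rstep tower_rules \<dots> (Fun symg [tower syme n, tower syme n])"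
    using rstep.root[of "Fun symf [Var 0, Var 0]" "Fun symg [Var 0, Var 0]" tower_rules
        "\<lambda>_. tower syme n"]
    by (simp add: tower_rules_def copy_rules_def)
  finally show ?thesis .
qed

lemma not_PSRF_tower_rules: "\<not> PSRF_trs tower_sig tower_rules"
proof
  let ?t = "Fun symf [tower symc 0, tower symd 0]"
  let ?L = "descendants tower_rules {?t}"
  assume "PSRF_trs tower_sig tower_rules"
  \<comment> \<open>The head \<open>h\<close> is left open to cover both the start term and the
    terms of the pigeonhole argument.\<close>
  moreover have pair: "Fun h [tower y m, tower z n] \<in> ground_terms tower_sig"
    if "h \<in> {symf, symg}" "{y, z} \<subseteq> {symc, symd, syme}" for h y m z n
    using that tower_in_terms[of y m] tower_in_terms[of z n]
    by (auto simp: ground_terms_def ground_def tower_sig_def intro!: terms.Fun)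
  then have "{?t} \<subseteq> ground_terms tower_sig"
    by blast
  ultimately have rec: "recognizable tower_sig ?L"
    by (auto simp: PSRF_trs_def)
  have diag: "Fun symg [tower syme n, tower syme n] \<in> ?L" for n
    using copied_tower_reachable by (simp add: descendants_def)
  obtain m n where mn: "m \<noteq> n" "Fun symg [tower syme m, tower syme n] \<in> ?L"
    using recognizable_pigeonhole[OF rec diag pair] by blast
  have "tower_config ?t"
    by (rule growing) auto
  then have "tower_config (Fun symg [tower syme m, tower syme n])"
    using mn(2) descendants_tower_config by (auto simp: descendants_def)
  \<comment> \<open>Only \<open>copied\<close> has root \<open>symg\<close>, and it forces
    \<open>m = n\<close>.\<close>
  then show False
    using mn(1) by (cases rule: tower_config.cases) (auto simp: tower_eq_iff)
qed

theorem mainTheorem13: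
  "\<exists>(\<Sigma> :: nat signature) (R :: (nat, nat) rules).
     ranked_alphabet \<Sigma> \<and> murg_trs \<Sigma> R \<and> \<not> PSRF_trs \<Sigma> R"
proof (intro exI conjI)
  show "ranked_alphabet tower_sig"
    by (simp add: ranked_alphabet_def tower_sig_def)
qed (fact murg_tower_rules not_PSRF_tower_rules)+

end
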